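(* There exists an absolute constant $c' > 0$ such that for every integer $k \ge 3$ there exist a set $S_k \subset \mathbb{Z}^2$ and an integer $n_k$ (which may depend on $k$) such that no $k+1$ distinct points of $S_k$ lie on a common line and $|S_k \cap [n]^2| \ge c' k n$ for all integers $n \ge n_k$.
   Context: $[n] = \{1,2,\dots,n\}$, so $[n]^2 \subset \mathbb{Z}^2$ is the $n \times n$ grid. Lines are those of the Euclidean plane $\mathbb{R}^2$. *)

theory Defs
  imports "HOL-Analysis.Analysis"
begin

definition grid :: "nat \<Rightarrow> (int \<times> int) set" where
  "grid n = {1..int n} \<times> {1..int n}"

definition to_plane :: "int \<times> int \<Rightarrow> real \<times> real" where
  "to_plane p = (real_of_int (fst p), real_of_int (snd p))"

definition no_points_on_line :: "nat \<Rightarrow> (int \<times> int) set \<Rightarrow> bool" where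
  "no_points_on_line m S \<longleftrightarrow>
     \<not> (\<exists>T \<subseteq> S. card T = m \<and> collinear (to_plane ` T))"

end

(*
  For k = 3 a greedy sequence works: x_n is chosen in the box [M]^2 with M = 24 (n + n0).
  If w(p, q) is the reciprocal of the height of the primitive direction of q - p, a line through
  p and q in [M]^2 contains at most 2 M w(p, q) points of [M]^2, and the sum of w(p, r)^2 over
  r in [M]^2 is O(M). By Markov's inequality most candidates x_n add only O(1) to the sum of w^2
  over pairs, and hence most add only O(1) to the sum of w over collinear triples; therefore the
  lines through three earlier points cover only a small part of [M]^2. Counting triples instead
  of pairs avoids the logarithm that spoils the same argument for k = 2.

  For larger k, take the union of floor(k/3) pairwise disjoint such sequences: each new one can
  avoid the previous ones because these contain only O(k M) points of [M]^2.
*)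

theory Submission imports Defs begin

section \<open>Lattice points of a grid on one line\<close>

definition nrm :: "int \<times> int \<Rightarrow> int" where
  "nrm v = max \<bar>fst v\<bar> \<bar>snd v\<bar>"

text \<open>The reciprocal of the height \<open>max \<bar>a\<bar> \<bar>b\<bar>\<close> of the primitive direction \<open>(a, b)\<close> of
  the line \<open>pq\<close>; it is \<open>0\<close> for \<open>p = q\<close> (as \<open>0 / 0\<close>).\<close>
definition weight :: "int \<times> int \<Rightarrow> int \<times> int \<Rightarrow> real" where
  "weight p q = real_of_int (gcd (fst q - fst p) (snd q - snd p)) / real_of_int (nrm (q - p))"

text \<open>The 2 by 2 determinant of \<open>q - p\<close> and \<open>r - p\<close> vanishes. This
  keeps collinearity of three lattice points inside integer arithmetic. In the degenerate case
  \<open>p = q\<close> it holds for every \<open>r\<close>.\<close>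

definition aligned :: "int \<times> int \<Rightarrow> int \<times> int \<Rightarrow> int \<times> int \<Rightarrow> bool" where
  "aligned p q r \<longleftrightarrow>
     (fst q - fst p) * (snd r - snd p) = (snd q - snd p) * (fst r - fst p)"

lemma weight_nonneg: "weight p q \<ge> 0"
  by (simp add: weight_def nrm_def)

lemma finite_grid [simp]: "finite (grid n)"
  by (simp add: grid_def)

lemma card_grid: "card (grid n) = n\<^sup>2"
  by (simp add: grid_def card_cartesian_product power2_eq_square)

lemma grid_mono: "m \<le> n \<Longrightarrow> grid m \<subseteq> grid n"
  by (auto simp: grid_def)

lemma card_residue_class_le:
  fixes h c :: int
  assumes "h > 0"
  shows "real (card {t \<in> {1..int M}. h dvd t - c}) \<le> real M / real_of_int h + 1"
proof -
  let ?A = "{t \<in> {1..int M}. h dvd t - c}"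
  \<comment> \<open>Members of one residue class share their remainder modulo \<open>h\<close>, so
    the quotient determines them. The shift by 1 moves the range to start at 0.\<close>
  have inj: "inj_on (\<lambda>t. (t - 1) div h) ?A"
  proof (rule inj_onI)
    fix s t assume s: "s \<in> ?A" and t: "t \<in> ?A" and e: "(s - 1) div h = (t - 1) div h"
    have "h dvd s - c" "h dvd t - c" using s t by auto
    then have "h dvd (s - c) - (t - c)" by (rule dvd_diff)
    then have "h dvd (s - 1) - (t - 1)" by simp
    then have "(s - 1) mod h = (t - 1) mod h" by (simp add: mod_eq_dvd_iff)
    with e have "s - 1 = t - 1" by (metis div_mult_mod_eq)
    then show "s = t" by simp
  qed
  have "(\<lambda>t. (t - 1) div h) ` ?A \<subseteq> {0..int M div h}"
    using assms by (auto simp: pos_imp_zdiv_nonneg_iff intro!: zdiv_mono1)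
  then have "card ?A \<le> card {0..int M div h}"
    using inj by (intro card_inj_on_le) auto
  also have "\<dots> = nat (int M div h + 1)" by simp
  finally have "real (card ?A) \<le> real_of_int (int M div h) + 1"
    using pos_imp_zdiv_nonneg_iff[OF assms, of "int M"] by linarith
  also have "real_of_int (int M div h) \<le> real_of_int (int M) / real_of_int h"
    by (rule real_of_int_div4)
  finally show ?thesis by simp
qed

text \<open>Let \<open>(a, b)\<close> be the primitive direction of \<open>pq\<close>. Since the
  line is not vertical, its points are determined by their first coordinates, and these lie in one
  residue class modulo \<open>\<bar>a\<bar>\<close>. In the wide case \<open>\<bar>a\<bar>\<close>
  is the height of the direction, so its reciprocal is the weight.\<close>

lemma card_line_le_wide:
  assumes p: "p \<in> grid M" and q: "q \<in> grid M"
    and ne: "p \<noteq> q"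
    and wide: "\<bar>snd q - snd p\<bar> \<le> \<bar>fst q - fst p\<bar>"
  shows "real (card {r \<in> grid M. aligned p q r}) \<le> 2 * real M * weight p q"
proof -
  define dx where "dx = fst q - fst p"
  define dy where "dy = snd q - snd p"
  define g where "g = gcd dx dy"
  define a where "a = dx div g"
  define b where "b = dy div g"
  have dx0: "dx \<noteq> 0"
    using ne wide by (auto simp: dx_def prod_eq_iff)
  have g0: "g > 0" using dx0 by (simp add: g_def)
  have da: "dx = a * g" and db: "dy = b * g"
    by (simp_all add: a_def b_def g_def)
  have cop: "coprime a b"
    unfolding a_def b_def g_def using dx0 by (intro div_gcd_coprime) auto
  have a0: "\<bar>a\<bar> > 0" using dx0 da by auto
  have w: "weight p q = 1 / real_of_int \<bar>a\<bar>"
  proof -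
    have "nrm (q - p) = \<bar>dx\<bar>" using wide by (simp add: nrm_def dx_def)
    then have "weight p q = real_of_int g / real_of_int (\<bar>a\<bar> * g)"
      using g0 unfolding weight_def dx_def[symmetric] dy_def[symmetric] g_def[symmetric]
      by (simp add: da abs_mult)
    then show ?thesis using g0 by simp
  qed
  let ?L = "{r \<in> grid M. aligned p q r}"
  have al: "dx * (snd r - snd p) = dy * (fst r - fst p)" if "r \<in> ?L" for r
    using that by (simp add: aligned_def dx_def dy_def)
  have inj: "inj_on fst ?L"
  proof (rule inj_onI)
    fix r s assume "r \<in> ?L" "s \<in> ?L" "fst r = fst s"
    then have "dx * (snd r - snd p) = dx * (snd s - snd p)" using al[of r] al[of s] by simp
    then show "r = s" using dx0 \<open>fst r = fst s\<close> by (simp add: prod_eq_iff)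
  qed
  have "fst ` ?L \<subseteq> {t \<in> {1..int M}. \<bar>a\<bar> dvd t - fst p}"
  proof (rule image_subsetI)
    fix r assume r: "r \<in> ?L"
    have "g * (a * (snd r - snd p)) = g * (b * (fst r - fst p))"
      using al[OF r] by (simp add: da db mult_ac)
    then have "a * (snd r - snd p) = b * (fst r - fst p)" using g0 by simp
    then have "a dvd b * (fst r - fst p)" by (metis dvd_triv_left)
    then have "a dvd fst r - fst p" using cop by (simp add: coprime_dvd_mult_right_iff)
    then show "fst r \<in> {t \<in> {1..int M}. \<bar>a\<bar> dvd t - fst p}"
      using r by (auto simp: grid_def)
  qed
  then have "card ?L \<le> card {t \<in> {1..int M}. \<bar>a\<bar> dvd t - fst p}"
    by (rule card_inj_on_le[OF inj _ finite_subset[of _ "{1..int M}"]]) auto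
  also have "real \<dots> \<le> real M / real_of_int \<bar>a\<bar> + 1"
    using card_residue_class_le[OF a0] by simp
  finally have 1: "real (card ?L) \<le> real M / real_of_int \<bar>a\<bar> + 1" by simp
  \<comment> \<open>As \<open>p\<close> and \<open>q\<close> both lie in the grid,
    \<open>\<bar>a\<bar>\<close> is at most \<open>M\<close>, so the extra 1 in the count is
    absorbed by the factor 2.\<close>
  have "\<bar>a\<bar> \<le> \<bar>dx\<bar>" using g0 by (simp add: da abs_mult mult_le_cancel_left1)
  also have "\<bar>dx\<bar> \<le> int M" using p q by (auto simp: dx_def grid_def)
  finally have "real_of_int \<bar>a\<bar> \<le> real M" by linarith
  then have "1 \<le> real M / real_of_int \<bar>a\<bar>" using a0 by (simp add: field_simps)
  with 1 show ?thesis by (simp add: w)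
qed

lemma card_line_le:
  assumes "p \<in> grid M" "q \<in> grid M" "p \<noteq> q"
  shows "real (card {r \<in> grid M. aligned p q r}) \<le> 2 * real M * weight p q"
proof (cases "\<bar>snd q - snd p\<bar> \<le> \<bar>fst q - fst p\<bar>")
  case True
  then show ?thesis using assms card_line_le_wide by blast
next
  case False
  \<comment> \<open>Reflection in the diagonal preserves the grid, the weight and alignment, and
    turns a steep line into a wide one.\<close>
  have "real (card {r \<in> grid M. aligned (prod.swap p) (prod.swap q) r})
      \<le> 2 * real M * weight (prod.swap p) (prod.swap q)"
    using assms False by (intro card_line_le_wide) (auto simp: grid_def)
  moreover have "weight (prod.swap p) (prod.swap q) = weight p q"
    by (simp add: weight_def nrm_def gcd.commute max.commute)
  moreover have "{r \<in> grid M. aligned (prod.swap p) (prod.swap q) r}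
      = prod.swap ` {r \<in> grid M. aligned p q r}"
  proof -
    have "r \<in> prod.swap ` {r \<in> grid M. aligned p q r}"
      if "r \<in> grid M" "aligned (prod.swap p) (prod.swap q) r" for r
      using that by (intro image_eqI[of _ _ "prod.swap r"]) (auto simp: grid_def aligned_def)
    then show ?thesis by (auto simp: grid_def aligned_def)
  qed
  ultimately show ?thesis by (simp add: card_image)
qed

section \<open>Second moment of the weight over the grid\<close>

definition punctured_square :: "nat \<Rightarrow> (int \<times> int) set" where
  "punctured_square M = {- int M..int M} \<times> {- int M..int M} - {(0, 0)}"

lemma finite_punctured_square [simp]: "finite (punctured_square M)"
  by (simp add: punctured_square_def)

lemma nrm_pos: "v \<noteq> (0, 0) \<Longrightarrow> nrm v > 0"
  by (cases v) (auto simp: nrm_def)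

lemma punctured_square_iff: "v \<in> punctured_square M \<longleftrightarrow> v \<noteq> (0, 0) \<and> nrm v \<le> int M"
  by (cases v) (auto simp: punctured_square_def nrm_def)

text \<open>The ring of points of norm \<open>k\<close> has at most \<open>12 * k\<close> elements,
  so it contributes at most \<open>12 / k^2\<close>. The subtracted term makes the induction
  telescope, via \<open>1 / (x + 1)^2 \<le> 1 / x - 1 / (x + 1)\<close>; what is used later is the
  uniform bound 24.\<close>

lemma sum_punctured_square_inverse_cube: "(\<Sum>v\<in>punctured_square (Suc M). 1 / real_of_int (nrm v) ^ 3) \<le> 24 - 12 / real (Suc M)"
proof -
  have ring: "(\<Sum>v\<in>punctured_square (Suc M) - punctured_square M. 1 / real_of_int (nrm v) ^ 3) \<le> 12 / real (Suc M) ^ 2" for M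
  proof -
    let ?k = "int (Suc M)"
    let ?R = "punctured_square (Suc M) - punctured_square M"
    have nR: "nrm v = ?k" if "v \<in> ?R" for v using that by (auto simp: punctured_square_iff)
    \<comment> \<open>The ring is the boundary of a square, covered by two vertical and two
      horizontal sides of \<open>2 * ?k + 1\<close> points each.\<close>
    have "?R \<subseteq> {-?k, ?k} \<times> {-?k..?k} \<union> {-?k..?k} \<times> {-?k, ?k}" (is "_ \<subseteq> ?A \<union> ?B")
    proof
      fix v assume v: "v \<in> ?R"
      obtain x y where "v = (x, y)" by (cases v)
      with nR[OF v] show "v \<in> ?A \<union> ?B"
        by (auto simp: nrm_def max_def abs_if split: if_splits)
    qed
    then have "card ?R \<le> card (?A \<union> ?B)" by (intro card_mono) auto
    also have "\<dots> \<le> card ?A + card ?B" by (rule card_Un_le)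
    also have "\<dots> = 4 * (2 * Suc M + 1)"
      by (simp add: card_cartesian_product card_insert_if nat_add_distrib)
    also have "\<dots> \<le> 12 * Suc M" by simp
    finally have c: "real (card ?R) \<le> 12 * real (Suc M)" by linarith
    have "(\<Sum>v\<in>?R. 1 / real_of_int (nrm v) ^ 3) = (\<Sum>v\<in>?R. 1 / real (Suc M) ^ 3)"
      by (intro sum.cong) (use nR in auto)
    also have "\<dots> = real (card ?R) * (1 / real (Suc M) ^ 3)" by simp
    also have "\<dots> \<le> 12 * real (Suc M) * (1 / real (Suc M) ^ 3)"
      by (intro mult_right_mono c) simp
    also have "\<dots> = 12 / real (Suc M) ^ 2"
      by (simp add: field_simps power3_eq_cube power2_eq_square del: of_nat_Suc)
    finally show ?thesis .
  qed
  have split: "(\<Sum>v\<in>punctured_square (Suc M). 1 / real_of_int (nrm v) ^ 3)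
     = (\<Sum>v\<in>punctured_square M. 1 / real_of_int (nrm v) ^ 3) + (\<Sum>v\<in>punctured_square (Suc M) - punctured_square M. 1 / real_of_int (nrm v) ^ 3)"
    for M
    by (subst sum.subset_diff[of "punctured_square M"]) (auto simp: punctured_square_iff)
  show ?thesis
  proof (induction M)
    case 0
    have "punctured_square 0 = {}" by (auto simp: punctured_square_def)
    then have "(\<Sum>v\<in>punctured_square 0. 1 / real_of_int (nrm v) ^ 3) = 0"
      by (simp only: sum.empty)
    moreover have "12 / real (Suc 0) ^ 2 = 12" "24 - 12 / real (Suc 0) = 12" by simp_all
    ultimately show ?case using ring[of 0] split[of 0] by linarith
  next
    case (Suc M)
    define x where "x = real (Suc M)"
    have x: "x > 0" "real (Suc (Suc M)) = x + 1" by (simp_all add: x_def)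
    have "12 / (x + 1) ^ 2 \<le> 12 / (x * (x + 1))"
      unfolding power2_eq_square using x(1)
      by (intro divide_left_mono mult_right_mono mult_pos_pos) auto
    also have "\<dots> = 12 / x - 12 / (x + 1)"
      using x(1) by (simp add: field_simps)
    finally have "12 / real (Suc (Suc M)) ^ 2 \<le> 12 / real (Suc M) - 12 / real (Suc (Suc M))"
      by (simp only: x(2) x_def)
    then show ?case using Suc ring[of "Suc M"] split[of "Suc M"] by linarith
  qed
qed

text \<open>Write \<open>r - p\<close> as \<open>g\<close> times a primitive vector
  \<open>v\<close>; then the weight is \<open>1 / nrm v\<close>. Each \<open>v\<close> occurs with
  at most \<open>M / nrm v\<close> multiples \<open>g\<close>, so the sum is at most
  \<open>M\<close> times the sum of inverse cubes of norms.\<close>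

lemma sum_weight_sq_le:
  assumes p: "p \<in> grid M"
  shows "(\<Sum>r\<in>grid M. (weight p r)\<^sup>2) \<le> 24 * real M"
proof -
  obtain M' where M': "M = Suc M'"
    using p by (cases M) (auto simp: grid_def)
  \<comment> \<open>\<open>T\<close> does not ask that \<open>v\<close> be primitive. The sum over
    \<open>T\<close> can only be larger, because all terms are nonnegative.\<close>
  define T where "T = (SIGMA v : punctured_square M. {1..int M div nrm v})"
  define G where "G r = gcd (fst r - fst p) (snd r - snd p)" for r
  define \<phi> where "\<phi> r = (((fst r - fst p) div G r, (snd r - snd p) div G r), G r)" for r
  define F where "F = (\<lambda>(v, g::int). 1 / real_of_int (nrm v) ^ 2)"
  let ?D = "grid M - {p}"
  have G0: "G r > 0" if "r \<in> ?D" for r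
    using that by (auto simp: G_def prod_eq_iff)
  have d: "fst r - fst p = (fst r - fst p) div G r * G r"
          "snd r - snd p = (snd r - snd p) div G r * G r" for r
    by (simp_all add: G_def)
  have n: "nrm (r - p) = nrm (fst (\<phi> r)) * G r" if "r \<in> ?D" for r
  proof -
    have "nrm (r - p) = max (\<bar>(fst r - fst p) div G r\<bar> * G r) (\<bar>(snd r - snd p) div G r\<bar> * G r)"
      using G0[OF that] d[of r] by (simp add: nrm_def) (metis abs_mult abs_of_pos)
    then show ?thesis
      using G0[OF that] by (simp add: \<phi>_def nrm_def max_mult_distrib_right)
  qed
  have inj: "inj_on \<phi> ?D"
  proof (rule inj_onI)
    fix r s assume "\<phi> r = \<phi> s"
    then have "fst r - fst p = fst s - fst p" "snd r - snd p = snd s - snd p"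
      using d[of r] d[of s] by (auto simp: \<phi>_def)
    then show "r = s" by (simp add: prod_eq_iff)
  qed
  have npos: "nrm (r - p) > 0" if "r \<in> ?D" for r
    using that by (intro nrm_pos) (auto simp: prod_eq_iff)
  have sub: "\<phi> ` ?D \<subseteq> T"
  proof (rule image_subsetI)
    fix r assume r: "r \<in> ?D"
    have M: "nrm (r - p) \<le> int M" using r p by (auto simp: nrm_def grid_def)
    have f0: "nrm (fst (\<phi> r)) > 0"
      using npos[OF r] n[OF r] G0[OF r] by (simp add: zero_less_mult_iff)
    have "nrm (fst (\<phi> r)) \<le> nrm (r - p)"
      using n[OF r] G0[OF r] f0 by (simp add: mult_le_cancel_left1)
    moreover have "G r \<le> int M div nrm (fst (\<phi> r))"
    proof -
      have "G r = nrm (r - p) div nrm (fst (\<phi> r))" using n[OF r] f0 by simp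
      also have "\<dots> \<le> int M div nrm (fst (\<phi> r))" using M f0 by (intro zdiv_mono1) auto
      finally show ?thesis .
    qed
    moreover have "fst (\<phi> r) \<noteq> (0, 0)" using f0 by (auto simp: nrm_def)
    ultimately have "(fst (\<phi> r), G r) \<in> T"
      using M G0[OF r] by (simp add: T_def punctured_square_iff)
    then show "\<phi> r \<in> T" by (simp add: \<phi>_def)
  qed
  have fT: "finite T" by (auto simp: T_def)
  \<comment> \<open>The term \<open>r = p\<close> vanishes, because division by zero gives
    0.\<close>
  have "(\<Sum>r\<in>grid M. (weight p r)\<^sup>2) = (\<Sum>r\<in>?D. (weight p r)\<^sup>2)"
    using p by (subst sum.remove[of _ p]) (auto simp: weight_def nrm_def)
  also have "\<dots> = (\<Sum>r\<in>?D. F (\<phi> r))"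
  proof (rule sum.cong[OF refl])
    fix r assume r: "r \<in> ?D"
    have "weight p r = real_of_int (G r) / real_of_int (nrm (fst (\<phi> r)) * G r)"
      by (simp only: weight_def n[OF r, symmetric]) (simp add: G_def)
    then have "weight p r = 1 / real_of_int (nrm (fst (\<phi> r)))" using G0[OF r] by simp
    then show "(weight p r)\<^sup>2 = F (\<phi> r)"
      by (simp add: F_def power_divide \<phi>_def)
  qed
  also have "\<dots> = (\<Sum>t\<in>\<phi> ` ?D. F t)" using inj by (simp add: sum.reindex)
  also have "\<dots> \<le> (\<Sum>t\<in>T. F t)" using sub fT by (intro sum_mono2) (auto simp: F_def)
  also have "\<dots> = (\<Sum>v\<in>punctured_square M. \<Sum>g\<in>{1..int M div nrm v}. 1 / real_of_int (nrm v) ^ 2)"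
    unfolding T_def F_def by (subst sum.Sigma) auto
  also have "\<dots> \<le> (\<Sum>v\<in>punctured_square M. real M * (1 / real_of_int (nrm v) ^ 3))"
  proof (rule sum_mono)
    fix v assume "v \<in> punctured_square M"
    then have v: "nrm v > 0" by (auto simp: punctured_square_iff nrm_pos)
    have "real_of_int (int M div nrm v) \<le> real_of_int (int M) / real_of_int (nrm v)"
      by (rule real_of_int_div4)
    then have "real_of_int (int M div nrm v) * (1 / real_of_int (nrm v) ^ 2)
       \<le> real M / real_of_int (nrm v) * (1 / real_of_int (nrm v) ^ 2)"
      by (intro mult_right_mono) auto
    then show "(\<Sum>g\<in>{1..int M div nrm v}. 1 / real_of_int (nrm v) ^ 2) \<le> real M * (1 / real_of_int (nrm v) ^ 3)"
      using v by (simp add: pos_imp_zdiv_nonneg_iff power2_eq_square power3_eq_cube mult_ac)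
  qed
  also have "\<dots> = real M * (\<Sum>v\<in>punctured_square M. 1 / real_of_int (nrm v) ^ 3)"
    by (simp add: sum_distrib_left)
  also have "\<dots> \<le> real M * 24"
    by (rule mult_left_mono)
       (use sum_punctured_square_inverse_cube[of M'] M' in \<open>auto intro: order_trans\<close>)
  finally show ?thesis by simp
qed

section \<open>The greedy choice of one sequence\<close>

lemma markov_card:
  fixes g :: "'a \<Rightarrow> real"
  assumes "finite A" "\<And>x. x \<in> A \<Longrightarrow> g x \<ge> 0"
  shows "a * real (card {x \<in> A. g x > a}) \<le> (\<Sum>x\<in>A. g x)"
proof -
  have "a * real (card {x \<in> A. g x > a}) = (\<Sum>x\<in>{x \<in> A. g x > a}. a)" by simp
  also have "\<dots> \<le> (\<Sum>x\<in>{x \<in> A. g x > a}. g x)" by (intro sum_mono) auto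
  also have "\<dots> \<le> (\<Sum>x\<in>A. g x)" using assms by (intro sum_mono2) auto
  finally show ?thesis .
qed

text \<open>The amount by which the sum of squared weights over pairs grows when \<open>r\<close> is
  appended as term \<open>n\<close>.\<close>

definition pair_energy :: "(nat \<Rightarrow> int \<times> int) \<Rightarrow> nat \<Rightarrow> int \<times> int \<Rightarrow> real" where
  "pair_energy f n r = (\<Sum>i<n. (weight (f i) r)\<^sup>2)"

text \<open>The analogous growth of the sum over collinear triples, where a triple is charged the
  weight of its two earliest terms.\<close>

definition triple_energy :: "(nat \<Rightarrow> int \<times> int) \<Rightarrow> nat \<Rightarrow> int \<times> int \<Rightarrow> real" where
  "triple_energy f n r =
     (\<Sum>j<n. \<Sum>i<j. if aligned (f i) (f j) r then weight (f i) (f j) else 0)"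

definition on_triple_line :: "(nat \<Rightarrow> int \<times> int) \<Rightarrow> nat \<Rightarrow> int \<times> int \<Rightarrow> bool" where
  "on_triple_line f n r \<longleftrightarrow>
     (\<exists>l<n. \<exists>j<l. \<exists>i<j. aligned (f i) (f j) (f l) \<and> aligned (f i) (f j) r)"

lemma on_triple_line_cong:
  assumes "\<And>y. y < n \<Longrightarrow> f y = g y" "on_triple_line f n r"
  shows "on_triple_line g n r"
proof -
  obtain l j i where 1: "l < n" "j < l" "i < j"
    and 2: "aligned (f i) (f j) (f l)" "aligned (f i) (f j) r"
    using assms(2) unfolding on_triple_line_def by blast
  have "f i = g i" "f j = g j" "f l = g l" using 1 by (auto intro!: assms(1))
  with 1 2 show ?thesis unfolding on_triple_line_def by metis
qed

text \<open>A union bound over five kinds of bad candidates. Their shares of the grid are at most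
  1/8, 1/24, 1/4, 1/4 and 1/9, with sum 7/9. The thresholds 4 and 4/3 are what Markov's inequality
  needs for the two shares of 1/4.\<close>

lemma greedy_step:
  assumes M: "M > 0" "24 * n \<le> M"
    and f: "\<And>i. i < n \<Longrightarrow> f i \<in> grid M" "inj_on f {..<n}"
    and U: "8 * card (U \<inter> grid M) \<le> M\<^sup>2"
    and E2: "\<And>j. j < n \<Longrightarrow> pair_energy f j (f j) \<le> 4"
    and E3: "\<And>l. l < n \<Longrightarrow> triple_energy f l (f l) \<le> 4/3"
  shows "\<exists>r \<in> grid M. r \<notin> U \<and> r \<notin> f ` {..<n} \<and> pair_energy f n r \<le> 4 \<and>
           triple_energy f n r \<le> 4/3 \<and> \<not> on_triple_line f n r"
proof -
  define m where "m = real M"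
  have m0: "m > 0" using M by (simp add: m_def)
  have nm: "real n \<le> m / 24" using M by (simp add: m_def)
  have line: "real (card {r \<in> grid M. aligned (f i) (f j) r}) \<le> 2 * m * weight (f i) (f j)"
    if "i < j" "j < n" for i j
  proof -
    have "f i \<noteq> f j" using that inj_onD[OF f(2), of i j] by auto
    then show ?thesis unfolding m_def using that by (intro card_line_le f) auto
  qed
  define B3 where "B3 = {r \<in> grid M. pair_energy f n r > 4}"
  define B4 where "B4 = {r \<in> grid M. triple_energy f n r > 4/3}"
  define B5 where "B5 = {r \<in> grid M. on_triple_line f n r}"
  have c1: "real (card (U \<inter> grid M)) \<le> m\<^sup>2 / 8"
  proof -
    have "real (8 * card (U \<inter> grid M)) \<le> real (M\<^sup>2)" using U by (simp only: of_nat_le_iff)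
    then show ?thesis by (simp add: m_def)
  qed
  have c2: "real (card (f ` {..<n})) \<le> m\<^sup>2 / 24"
  proof -
    have "real (card (f ` {..<n})) \<le> real n" using card_image_le[of "{..<n}" f] by simp
    also have "\<dots> \<le> m / 24" by (rule nm)
    also have "m \<le> m\<^sup>2" using M by (simp add: m_def power2_eq_square)
    finally show ?thesis by simp
  qed
  have c3: "real (card B3) \<le> m\<^sup>2 / 4"
  proof -
    have "4 * real (card B3) \<le> (\<Sum>r\<in>grid M. pair_energy f n r)"
      unfolding B3_def by (rule markov_card) (auto simp: pair_energy_def intro: sum_nonneg)
    also have "\<dots> = (\<Sum>i<n. \<Sum>r\<in>grid M. (weight (f i) r)\<^sup>2)"
      unfolding pair_energy_def by (rule sum.swap)
    also have "\<dots> \<le> (\<Sum>i<n. 24 * m)"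
      unfolding m_def by (intro sum_mono sum_weight_sq_le f) auto
    also have "\<dots> = 24 * m * real n" by simp
    also have "\<dots> \<le> 24 * m * (m / 24)" using nm m0 by (intro mult_left_mono) auto
    finally show ?thesis by (simp add: power2_eq_square)
  qed
  \<comment> \<open>A pair contributes its weight once for each grid point on its line, hence at
    most \<open>2 * m\<close> times the squared weight. The total is thus controlled by the pair
    energies bounded in \<open>E2\<close>.\<close>
  have c4: "real (card B4) \<le> m\<^sup>2 / 4"
  proof -
    have "4/3 * real (card B4) \<le> (\<Sum>r\<in>grid M. triple_energy f n r)"
      unfolding B4_def
      by (rule markov_card) (auto simp: triple_energy_def weight_nonneg intro!: sum_nonneg)
    also have "\<dots> = (\<Sum>j<n. \<Sum>i<j. \<Sum>r\<in>grid M. if aligned (f i) (f j) r then weight (f i) (f j) else 0)"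
      unfolding triple_energy_def
      by (subst sum.swap, rule sum.cong[OF refl], rule sum.swap)
    also have "\<dots> = (\<Sum>j<n. \<Sum>i<j. weight (f i) (f j) * real (card {r \<in> grid M. aligned (f i) (f j) r}))"
      by (intro sum.cong refl) (simp add: sum.If_cases Int_def)
    also have "\<dots> \<le> (\<Sum>j<n. \<Sum>i<j. weight (f i) (f j) * (2 * m * weight (f i) (f j)))"
      by (intro sum_mono mult_left_mono line weight_nonneg) auto
    also have "\<dots> = 2 * m * (\<Sum>j<n. pair_energy f j (f j))"
      by (simp add: pair_energy_def sum_distrib_left power2_eq_square mult_ac)
    also have "\<dots> \<le> 2 * m * (\<Sum>j<n. 4)"
      using m0 E2 by (intro mult_left_mono sum_mono) auto
    also have "\<dots> = 8 * m * real n" by simp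
    also have "\<dots> \<le> 8 * m * (m / 24)" using nm m0 by (intro mult_left_mono) auto
    finally show ?thesis by (simp add: power2_eq_square)
  qed
  \<comment> \<open>Each aligned triple \<open>i < j < l\<close> spoils at most
    \<open>2 * m * weight (f i) (f j)\<close> points; summed over triples, this is
    \<open>2 * m\<close> times the triple energies bounded in \<open>E3\<close>.\<close>
  have c5: "real (card B5) \<le> m\<^sup>2 / 9"
  proof -
    let ?L = "\<lambda>l j i. {r \<in> grid M. aligned (f i) (f j) (f l) \<and> aligned (f i) (f j) r}"
    have "B5 = (\<Union>l<n. \<Union>j<l. \<Union>i<j. ?L l j i)"
      by (auto simp: B5_def on_triple_line_def)
    also have "card \<dots> \<le> (\<Sum>l<n. \<Sum>j<l. \<Sum>i<j. card (?L l j i))"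
      by (intro order_trans[OF card_UN_le] sum_mono) auto
    finally have "card B5 \<le> (\<Sum>l<n. \<Sum>j<l. \<Sum>i<j. card (?L l j i))" .
    then have "real (card B5) \<le> real (\<Sum>l<n. \<Sum>j<l. \<Sum>i<j. card (?L l j i))"
      by (simp only: of_nat_le_iff)
    also have "\<dots> = (\<Sum>l<n. \<Sum>j<l. \<Sum>i<j. real (card (?L l j i)))" by simp
    also have "\<dots> \<le> (\<Sum>l<n. \<Sum>j<l. \<Sum>i<j.
                    2 * m * (if aligned (f i) (f j) (f l) then weight (f i) (f j) else 0))"
    proof (intro sum_mono)
      fix l j i assume "l \<in> {..<n}" "j \<in> {..<l}" "i \<in> {..<j}"
      then show "real (card (?L l j i))
          \<le> 2 * m * (if aligned (f i) (f j) (f l) then weight (f i) (f j) else 0)"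
        using line[of i j] by auto
    qed
    also have "\<dots> = 2 * m * (\<Sum>l<n. triple_energy f l (f l))"
      by (simp only: triple_energy_def sum_distrib_left)
    also have "\<dots> \<le> 2 * m * (\<Sum>l<n. 4/3)"
      using m0 E3 by (intro mult_left_mono sum_mono) auto
    also have "\<dots> = 8/3 * m * real n" by simp
    also have "\<dots> \<le> 8/3 * m * (m / 24)" using nm m0 by (intro mult_left_mono) auto
    finally show ?thesis by (simp add: power2_eq_square)
  qed
  let ?B = "(U \<inter> grid M) \<union> f ` {..<n} \<union> B3 \<union> B4 \<union> B5"
  have "card ?B \<le> card (U \<inter> grid M) + card (f ` {..<n}) + card B3 + card B4 + card B5"
    by (intro order_trans[OF card_Un_le] add_mono) auto
  then have "real (card ?B) \<le> real (card (U \<inter> grid M)) + real (card (f ` {..<n}))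
      + real (card B3) + real (card B4) + real (card B5)"
    by linarith
  also have "\<dots> < m\<^sup>2" using c1 c2 c3 c4 c5 m0 zero_less_power[OF m0, of 2] by linarith
  also have "\<dots> = real (card (grid M))" by (simp add: card_grid m_def)
  finally have "card ?B < card (grid M)" by simp
  moreover have "finite ?B" by (auto simp: B3_def B4_def B5_def)
  ultimately obtain r where "r \<in> grid M" "r \<notin> ?B"
    using card_mono[of ?B "grid M"] by (meson linorder_not_le subsetI)
  then show ?thesis by (auto simp: B3_def B4_def B5_def not_less)
qed

lemma greedy_sequence:
  assumes U: "\<And>M. M \<ge> n0 \<Longrightarrow> 8 * card (U \<inter> grid M) \<le> M\<^sup>2" and "n0 > 0"
  shows "\<exists>f. inj f \<and> (\<forall>n. f n \<in> grid (24 * (n + n0)) - U) \<and>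
           (\<forall>n. \<not> on_triple_line f n (f n))"
proof -
  define P where "P f n r \<longleftrightarrow> r \<in> grid (24 * (n + n0)) \<and> r \<notin> U \<and> r \<notin> f ` {..<n} \<and>
     pair_energy f n r \<le> 4 \<and> triple_energy f n r \<le> 4/3 \<and> \<not> on_triple_line f n r" for f n r
  have "\<exists>f. \<forall>n. P f n (f n)"
  \<comment> \<open>The choice principle first requires that \<open>P f n\<close> depend only on the
    values of \<open>f\<close> below \<open>n\<close>.\<close>
  proof (rule dependent_wellorder_choice)
    fix r :: "int \<times> int" and f g :: "nat \<Rightarrow> int \<times> int" and n
    assume eq: "\<And>y. y < n \<Longrightarrow> f y = g y"
    then have "f ` {..<n} = g ` {..<n}" by auto
    moreover have "pair_energy f n r = pair_energy g n r"
      unfolding pair_energy_def by (intro sum.cong) (use eq in auto)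
    moreover have "triple_energy f n r = triple_energy g n r"
      unfolding triple_energy_def by (intro sum.cong) (use eq in auto)
    moreover have "on_triple_line f n r = on_triple_line g n r"
      using on_triple_line_cong[of n f g r] on_triple_line_cong[of n g f r] eq by metis
    ultimately show "P f n r = P g n r" by (simp add: P_def)
  next
    fix n and f :: "nat \<Rightarrow> int \<times> int"
    assume IH: "\<And>y. y < n \<Longrightarrow> P f y (f y)"
    have "f i \<in> grid (24 * (n + n0))" if "i < n" for i
      using IH[OF that] grid_mono[of "24 * (i + n0)" "24 * (n + n0)"] that by (auto simp: P_def)
    moreover have "inj_on f {..<n}"
    proof (rule linorder_inj_onI)
      fix i j assume "i < j" "i \<in> {..<n}" "j \<in> {..<n}"
      then show "f i \<noteq> f j" using IH[of j] unfolding P_def by (metis imageI lessThan_iff)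
    qed auto
    moreover have "8 * card (U \<inter> grid (24 * (n + n0))) \<le> (24 * (n + n0))\<^sup>2"
      by (rule U) simp
    ultimately show "\<exists>r. P f n r"
      using greedy_step[of "24 * (n + n0)" n f U] IH \<open>n0 > 0\<close> by (auto simp: P_def)
  qed
  then obtain f where f: "\<And>n. P f n (f n)" by blast
  have "inj f"
  proof (rule linorder_injI)
    fix i j :: nat assume "i < j"
    then show "f i \<noteq> f j" using f[of j] unfolding P_def by (metis imageI lessThan_iff)
  qed
  then show ?thesis using f by (auto simp: P_def)
qed

section \<open>Collinear subsets of the plane and of unions\<close>

lemma aligned_if_collinear:
  assumes "collinear (to_plane ` T)" "p \<in> T" "q \<in> T" "r \<in> T"
  shows "aligned p q r"
proof -
  obtain u where u: "\<And>x y. x \<in> to_plane ` T \<Longrightarrow> y \<in> to_plane ` T \<Longrightarrow> \<exists>c. x - y = c *\<^sub>R u"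
    using assms(1) unfolding collinear_def by blast
  obtain c d where c: "to_plane q - to_plane p = c *\<^sub>R u" and d: "to_plane r - to_plane p = d *\<^sub>R u"
    using u assms(2-4) by (meson imageI)
  have 1: "real_of_int (fst q) - real_of_int (fst p) = c * fst u"
    using arg_cong[OF c, of fst] by (simp add: to_plane_def)
  have 2: "real_of_int (snd q) - real_of_int (snd p) = c * snd u"
    using arg_cong[OF c, of snd] by (simp add: to_plane_def)
  have 3: "real_of_int (fst r) - real_of_int (fst p) = d * fst u"
    using arg_cong[OF d, of fst] by (simp add: to_plane_def)
  have 4: "real_of_int (snd r) - real_of_int (snd p) = d * snd u"
    using arg_cong[OF d, of snd] by (simp add: to_plane_def)
  \<comment> \<open>Both differences are multiples of the same \<open>u\<close>, so both products
    equal \<open>c * d * fst u * snd u\<close>.\<close>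
  have "real_of_int ((fst q - fst p) * (snd r - snd p)) = real_of_int ((snd q - snd p) * (fst r - fst p))"
    by (simp add: 1 2 3 4)
  then show ?thesis by (simp only: aligned_def of_int_eq_iff)
qed

lemma no_four_on_line_range:
  assumes "\<And>n. \<not> on_triple_line f n (f n)"
  shows "no_points_on_line 4 (range f)"
  unfolding no_points_on_line_def
proof
  assume "\<exists>T\<subseteq>range f. card T = 4 \<and> collinear (to_plane ` T)"
  then obtain T where T: "T \<subseteq> range f" "card T = 4" "collinear (to_plane ` T)" by blast
  from T(1) obtain I where I: "T = f ` I" "inj_on f I" by (auto simp: subset_image_inj)
  then have "card I = 4" using T(2) by (simp add: card_image)
  then have "finite I" by (intro card_ge_0_finite) simp
  \<comment> \<open>With the four indices in increasing order, the last point lies on the line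
    through three earlier ones.\<close>
  define xs where "xs = sorted_list_of_set I"
  have xs: "length xs = 4" "sorted_wrt (<) xs" "set xs = I"
    using \<open>card I = 4\<close> \<open>finite I\<close> strict_sorted_list_of_set[of I] by (simp_all add: xs_def)
  have "xs ! 0 < xs ! 1" "xs ! 1 < xs ! 2" "xs ! 2 < xs ! 3"
    using xs(1) by (auto intro!: sorted_wrt_nth_less[OF xs(2)])
  moreover have "f (xs ! k) \<in> T" if "k < 4" for k
    using that xs I by (auto intro!: imageI nth_mem)
  then have "aligned (f (xs ! 0)) (f (xs ! 1)) (f (xs ! 2))"
    "aligned (f (xs ! 0)) (f (xs ! 1)) (f (xs ! 3))"
    by (auto intro!: aligned_if_collinear[OF T(3)])
  ultimately have "on_triple_line f (xs ! 3) (f (xs ! 3))"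
    unfolding on_triple_line_def by blast
  then show False using assms by blast
qed

text \<open>The definition forbids exactly \<open>m\<close> collinear points; a larger or infinite
  collinear set contains such a subset. Finiteness is stated separately because \<open>card\<close>
  of an infinite set is 0.\<close>

lemma no_points_on_line_D:
  assumes "no_points_on_line m S" "T \<subseteq> S" "collinear (to_plane ` T)" "m > 0"
  shows "finite T \<and> card T < m"
proof (rule ccontr)
  assume "\<not> (finite T \<and> card T < m)"
  then obtain T' where T': "T' \<subseteq> T" "card T' = m"
    by (metis infinite_arbitrarily_large linorder_not_le obtain_subset_with_card_n)
  then have "collinear (to_plane ` T')"
    using assms(3) by (meson collinear_subset image_mono)
  then show False using assms(1,2) T' unfolding no_points_on_line_def by blast
qed

lemma no_points_on_line_mono:
  assumes "no_points_on_line m S" "m \<le> m'" "m > 0"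
  shows "no_points_on_line m' S"
  unfolding no_points_on_line_def
proof
  assume "\<exists>T\<subseteq>S. card T = m' \<and> collinear (to_plane ` T)"
  then obtain T where "T \<subseteq> S" "card T = m'" "collinear (to_plane ` T)" by blast
  then show False using no_points_on_line_D[OF assms(1), of T] assms(2,3) by simp
qed

lemma no_points_on_line_Un:
  assumes "no_points_on_line (Suc a) A" "no_points_on_line (Suc b) B"
  shows "no_points_on_line (Suc (a + b)) (A \<union> B)"
  unfolding no_points_on_line_def
proof
  assume "\<exists>T\<subseteq>A \<union> B. card T = Suc (a + b) \<and> collinear (to_plane ` T)"
  then obtain T where T: "T \<subseteq> A \<union> B" "card T = Suc (a + b)" "collinear (to_plane ` T)" by blast
  have "collinear (to_plane ` (T \<inter> A))" "collinear (to_plane ` (T \<inter> B))"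
    using T(3) by (auto intro: collinear_subset)
  then have "card (T \<inter> A) < Suc a" "card (T \<inter> B) < Suc b"
    using no_points_on_line_D[OF assms(1), of "T \<inter> A"] no_points_on_line_D[OF assms(2), of "T \<inter> B"]
    by auto
  moreover have "T = (T \<inter> A) \<union> (T \<inter> B)" using T(1) by auto
  then have "card T \<le> card (T \<inter> A) + card (T \<inter> B)" by (metis card_Un_le)
  ultimately show False using T(2) by simp
qed

section \<open>Counting by columns and uniting disjoint sequences\<close>

lemma collinear_vertical: "collinear (to_plane ` ({x} \<times> Y))"
  unfolding collinear_def
proof (intro exI[of _ "(0, 1)"] ballI)
  fix p q assume "p \<in> to_plane ` ({x} \<times> Y)" "q \<in> to_plane ` ({x} \<times> Y)"
  then have "p - q = (snd p - snd q) *\<^sub>R (0, 1)" by (auto simp: to_plane_def)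
  then show "\<exists>c. p - q = c *\<^sub>R (0, 1)" by blast
qed

text \<open>The grid is a union of \<open>M\<close> columns, each on a vertical line. This bound
  keeps the earlier sequences sparse enough for a new one to avoid them.\<close>

lemma card_grid_le_of_no_points_on_line:
  assumes "no_points_on_line (Suc a) S"
  shows "card (S \<inter> grid M) \<le> a * M"
proof -
  have "S \<inter> grid M = (\<Union>x\<in>{1..int M}. S \<inter> ({x} \<times> {1..int M}))"
    by (auto simp: grid_def)
  also have "card \<dots> \<le> (\<Sum>x\<in>{1..int M}. card (S \<inter> ({x} \<times> {1..int M})))"
    by (rule card_UN_le) simp
  also have "\<dots> \<le> (\<Sum>x\<in>{1..int M}. a)"
  proof (rule sum_mono)
    fix x
    have "collinear (to_plane ` (S \<inter> ({x} \<times> {1..int M})))"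
      by (rule collinear_subset[OF collinear_vertical]) auto
    then show "card (S \<inter> ({x} \<times> {1..int M})) \<le> a"
      using no_points_on_line_D[OF assms, of "S \<inter> ({x} \<times> {1..int M})"] by auto
  qed
  finally show ?thesis by (simp add: mult.commute)
qed

lemma exists_disjoint_union:
  "\<exists>S n0. no_points_on_line (Suc (3 * m)) S \<and>
     (\<forall>n\<ge>n0. real (card (S \<inter> grid n)) \<ge> real m * real n / 48)"
proof (induction m)
  case 0
  have "no_points_on_line (Suc (3 * 0)) {}" by (auto simp: no_points_on_line_def)
  then show ?case by auto
next
  case (Suc m)
  then obtain U n1 where U: "no_points_on_line (Suc (3 * m)) U"
    and n1: "\<And>n. n \<ge> n1 \<Longrightarrow> real (card (U \<inter> grid n)) \<ge> real m * real n / 48"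
    by blast
  \<comment> \<open>The columns give at most \<open>3 * m * M\<close> points of \<open>U\<close>, so
    \<open>8 * (3 * m * M) \<le> M^2\<close> once \<open>M\<close> is at least
    \<open>24 * m\<close>. The 1 makes \<open>n0\<close> positive when \<open>m = 0\<close>.\<close>
  define n0 where "n0 = 24 * m + 1"
  have "8 * card (U \<inter> grid M) \<le> M\<^sup>2" if "M \<ge> n0" for M
  proof -
    have "8 * card (U \<inter> grid M) \<le> 8 * (3 * m * M)"
      by (rule mult_left_mono[OF card_grid_le_of_no_points_on_line[OF U]]) simp
    also have "\<dots> = (24 * m) * M" by simp
    also have "\<dots> \<le> M * M" using that by (intro mult_right_mono) (auto simp: n0_def)
    finally show ?thesis by (simp add: power2_eq_square)
  qed
  then obtain f where f: "inj f" "\<And>n. f n \<in> grid (24 * (n + n0)) - U" "\<And>n. \<not> on_triple_line f n (f n)"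
    using greedy_sequence[of n0 U] by (auto simp: n0_def)
  have "no_points_on_line (Suc (3 * m + 3)) (U \<union> range f)"
    using no_points_on_line_Un[OF U, of 3 "range f"] no_four_on_line_range[OF f(3)] by simp
  moreover have "real (card ((U \<union> range f) \<inter> grid n)) \<ge> real (Suc m) * real n / 48"
    if n: "n \<ge> max n1 (48 * (n0 + 1))" for n
  proof -
    have "f ` {..<n div 24 - n0} \<subseteq> range f \<inter> grid n"
    proof (rule image_subsetI)
      fix i assume "i \<in> {..<n div 24 - n0}"
      then have "i + n0 \<le> n div 24" by simp
      then have "24 * (i + n0) \<le> n" by presburger
      then show "f i \<in> range f \<inter> grid n" using grid_mono f(2)[of i] by blast
    qed
    then have "card (f ` {..<n div 24 - n0}) \<le> card (range f \<inter> grid n)"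
      by (intro card_mono) auto
    moreover have "card (f ` {..<n div 24 - n0}) = n div 24 - n0"
      using f(1) by (subst card_image) (auto intro: inj_on_subset)
    \<comment> \<open>Rounding and the offset \<open>n0\<close> cost at most half of the main term
      \<open>n / 24\<close> once \<open>n\<close> reaches \<open>48 * (n0 + 1)\<close>; hence the
      density 1/48 per sequence.\<close>
    moreover have "n \<le> 48 * (n div 24 - n0)"
    proof -
      define q where "q = n div 24"
      have "n < 24 * q + 24" unfolding q_def by presburger
      moreover have "48 * (n0 + 1) \<le> n" using n by simp
      ultimately have "n + 48 * n0 \<le> 48 * q" by simp
      then show ?thesis by (simp add: q_def diff_mult_distrib2)
    qed
    ultimately have "real n / 48 \<le> real (card (range f \<inter> grid n))" by linarith
    \<comment> \<open>The new sequence avoids \<open>U\<close>, so the counts add.\<close>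
    moreover have "card ((U \<union> range f) \<inter> grid n) = card (U \<inter> grid n) + card (range f \<inter> grid n)"
      using f(2) by (subst card_Un_disjoint[symmetric]) (auto simp: Int_Un_distrib2)
    ultimately show ?thesis using n1[of n] n by (simp add: add_divide_distrib ring_distribs)
  qed
  ultimately show ?case by (intro exI[of _ "U \<union> range f"] exI[of _ "max n1 (48 * (n0 + 1))"]) auto
qed

theorem mainTheorem2:
  "\<exists>c::real. c > 0 \<and>
     (\<forall>k::nat. k \<ge> 3 \<longrightarrow>
       (\<exists>(S :: (int \<times> int) set) (n0 :: nat).
          no_points_on_line (k + 1) S \<and>
          (\<forall>n::nat. n \<ge> n0 \<longrightarrow> real (card (S \<inter> grid n)) \<ge> c * real k * real n)))"
proof (rule exI[of _ "1/240"], intro conjI allI impI)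
  fix k :: nat assume k: "k \<ge> 3"
  define m where "m = k div 3"
  from exists_disjoint_union[of m] obtain S n0 where S: "no_points_on_line (Suc (3 * m)) S"
    and n0: "\<forall>n\<ge>n0. real (card (S \<inter> grid n)) \<ge> real m * real n / 48"
    by (elim exE conjE)
  \<comment> \<open>Since \<open>m\<close> is at least 1,
    \<open>k \<le> 3 * m + 2 \<le> 5 * m\<close>, with equality at \<open>k = 5\<close>. The
    constant is therefore 1/48 divided by 5.\<close>
  have "k < 3 * m + 3" unfolding m_def by presburger
  with k have "k \<le> 5 * m" by arith
  then have "real k \<le> 5 * real m" by linarith
  then have "1/240 * real k * real n \<le> real m * real n / 48" for n
    using mult_right_mono[of "real k" "5 * real m" "real n"] by simp
  then have "real (card (S \<inter> grid n)) \<ge> 1/240 * real k * real n" if "n \<ge> n0" for n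
    using n0 that by (meson order_trans)
  moreover have "no_points_on_line (k + 1) S"
    by (rule no_points_on_line_mono[OF S]) (simp_all add: m_def)
  ultimately show "\<exists>(S :: (int \<times> int) set) (n0 :: nat).
          no_points_on_line (k + 1) S \<and>
          (\<forall>n::nat. n \<ge> n0 \<longrightarrow> real (card (S \<inter> grid n)) \<ge> 1/240 * real k * real n)"
    by blast
qed simp

end
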